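(* Let $z(w,t)=\sum_{k=1}^{2^s}2^{s/2}z_k(w)\,1_{(\frac{k-1}{2^s},\frac k{2^s}]}(t)$ be a simple predictable process, where each $z_k$ is an $\mathcal{F}_{(k-1)/2^s}$-measurable random variable, and let $F\in\mathbf{P}_H$. Then $$E\Big[F\Big(w-\int_0^{\cdot}z(w,u)\,du\Big)\exp\Big\{\int_0^1z(w,t)\,dw(t)-\frac12\int_0^1|z(w,t)|^2\,dt\Big\}\Big]=E[F].$$
   Context: $(\mathscr{W},\mathscr{B}(\mathscr{W}),\gamma)$ is the Wiener space: $\mathscr{W}$ is the set of continuous paths $w:[0,1]\to\mathbb{R}$ with $w(0)=0$, with the $\sigma$-field generated by the topology of uniform convergence, and $\gamma$ is Wiener measure; $E$ is expectation under $\gamma$, and $\{\mathcal{F}_t\}_{0\le t\le1}$ is the natural filtration of $\mathscr{W}$ (generated by the coordinate process $w(t)$). $\mathscr{H}\subset\mathscr{W}$ is the Cameron-Martin space of absolutely continuous $h$ with square-integrable derivative $\dot h$. For $h\in\mathscr{H}$, $[h](w):=\int_0^1\dot h(t)\,dw(t)$ (Wiener integral). For $s\in\mathbb{N}$ and $k=1,\dots,2^s$, $\sigma_k^s(t):=2^{s/2}\int_0^t1_{(\frac{k-1}{2^s},\frac k{2^s}]}(u)\,du\in\mathscr{H}$. $\mathbf{P}_H$ is the space of polynomials in (finitely many of) $\{[e_i](w)\}$, where $\{e_i\}$ is the Haar system; equivalently, all polynomials in $\{[\sigma_k^s](w):k=1,\dots,2^s,\ s\in\mathbb{N}\}$. Note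 $s$ in the definition of $z$ is fixed and need not bound the levels occurring in $F$. *)

theory Defs
  imports "HOL-Probability.Probability"
begin

section \<open>Wiener space\<close>

text \<open>
  Paths are functions on \<open>[0,1]\<close>, encoded as elements of \<open>real \<Rightarrow> real\<close> that are extensional
  on \<open>{0..1}\<close>; this is built into \<^const>\<open>cfunspace\<close>, whose metric is the supremum metric.
\<close>

definition wiener_metric :: "(real \<Rightarrow> real) metric" where
  "wiener_metric =
     submetric (cfunspace (top_of_set {0..1}) euclidean_metric) {w. w 0 = 0}"

abbreviation wiener_space :: "(real \<Rightarrow> real) set" where
  "wiener_space \<equiv> mspace wiener_metric"

lemma wiener_space_iff:
  "w \<in> wiener_space \<longleftrightarrow> w \<in> extensional {0..1} \<and> continuous_on {0..1} w \<and> w 0 = 0"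
proof -
  have "Met_TC.mbounded (w ` {0..1})" if "continuous_on {0..1} w" for w :: "real \<Rightarrow> real"
    using compact_imp_bounded[OF compact_continuous_image[OF that]] by auto
  then show ?thesis
    by (auto simp: wiener_metric_def Met_TC.fspace_def)
qed

definition wiener_borel :: "(real \<Rightarrow> real) measure" where
  "wiener_borel = sigma wiener_space {U. openin (mtopology_of wiener_metric) U}"

definition wiener_filtration :: "real \<Rightarrow> (real \<Rightarrow> real) measure" where
  "wiener_filtration t =
     sigma wiener_space {{w \<in> wiener_space. w u \<in> B} | u B. u \<in> {0..t} \<and> B \<in> sets borel}"

text \<open>
  Wiener measure is the (unique) law on path space under which the coordinate process is a
  standard Brownian motion. Starting at \<open>0\<close> and continuity are part of \<^const>\<open>wiener_space\<close>.
\<close>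

definition wiener_measure :: "(real \<Rightarrow> real) measure \<Rightarrow> bool" where
  "wiener_measure \<gamma> \<longleftrightarrow>
     prob_space \<gamma> \<and> sets \<gamma> = sets wiener_borel \<and>
     (\<forall>s t. 0 \<le> s \<and> s < t \<and> t \<le> 1 \<longrightarrow>
        distributed \<gamma> lborel (\<lambda>w. w t - w s) (normal_density 0 (sqrt (t - s)))) \<and>
     (\<forall>(n::nat) \<tau>. 0 \<le> \<tau> 0 \<and> (\<forall>i<n. \<tau> i < \<tau> (Suc i)) \<and> \<tau> n \<le> 1 \<longrightarrow>
        prob_space.indep_vars \<gamma> (\<lambda>_. borel) (\<lambda>i w. w (\<tau> (Suc i)) - w (\<tau> i)) {..<n})"


section \<open>Stochastic integrals of step functions\<close>

definition step_rep :: "(real \<Rightarrow> real) \<Rightarrow> nat \<Rightarrow> (nat \<Rightarrow> real) \<Rightarrow> (nat \<Rightarrow> real) \<Rightarrow> bool" where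
  "step_rep f n \<tau> c \<longleftrightarrow>
     \<tau> 0 = 0 \<and> \<tau> n = 1 \<and> (\<forall>i<n. \<tau> i < \<tau> (Suc i)) \<and>
     (\<forall>u\<in>{0<..1}. f u = (\<Sum>i<n. c i * indicator {\<tau> i<..\<tau> (Suc i)} u))"

text \<open>
  The integral \<open>\<integral>\<^sub>0\<^sup>1 f(t) dw(t)\<close> of a left-continuous step function \<open>f\<close> (unspecified for other
  \<open>f\<close>). For step integrands the Wiener integral and, applied path by path to a simple
  predictable process, the Ito integral are given by this elementary sum. The lemma
  \<open>stoch_integral_eq\<close> below shows that it does not depend on the representation of \<open>f\<close>.
\<close>

definition stoch_integral :: "(real \<Rightarrow> real) \<Rightarrow> (real \<Rightarrow> real) \<Rightarrow> real" where
  "stoch_integral f w =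
     (THE I. \<exists>n \<tau> c. step_rep f n \<tau> c \<and> I = (\<Sum>i<n. c i * (w (\<tau> (Suc i)) - w (\<tau> i))))"

lemma finite_jump_decomposition:
  fixes w :: "real \<Rightarrow> real"
  assumes "finite P"
  shows "\<exists>D. \<forall>y\<in>P. w y = (\<Sum>x\<in>P. D x * (if x \<le> y then 1 else 0))"
  using assms
proof (induction rule: finite_linorder_max_induct)
  case empty
  then show ?case by simp
next
  case (insert b A)
  then obtain D where D: "\<forall>y\<in>A. w y = (\<Sum>x\<in>A. D x * (if x \<le> y then 1 else 0))" by blast
  define D' where "D' = D(b := w b - (\<Sum>x\<in>A. D x))"
  have b: "b \<notin> A" using insert by auto
  have eq: "(\<Sum>x\<in>A. D' x * (if x \<le> y then 1 else 0)) = (\<Sum>x\<in>A. D x * (if x \<le> y then 1 else 0))"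
    for y by (rule sum.cong) (use b in \<open>auto simp: D'_def\<close>)
  have top: "(\<Sum>x\<in>A. D x * (if x \<le> b then 1 else 0)) = (\<Sum>x\<in>A. D x)"
    by (rule sum.cong) (use insert in \<open>force+\<close>)
  have "w y = (\<Sum>x\<in>insert b A. D' x * (if x \<le> y then 1 else 0))" if "y \<in> insert b A" for y
  proof (cases "y = b")
    case True
    then show ?thesis using insert(1) b eq[of b] top by (simp add: D'_def)
  next
    case False
    then have "y \<in> A" "\<not> b \<le> y" using that insert by force+
    then show ?thesis using insert(1) b eq[of y] D by simp
  qed
  then show ?case by blast
qed

lemma step_rep_mono:
  assumes "step_rep f n \<tau> c" "i \<le> j" "j \<le> n"
  shows "\<tau> i \<le> \<tau> j"
  using assms(2,3)
proof (induction j rule: dec_induct)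
  case (step m)
  have "\<tau> m < \<tau> (Suc m)" using assms(1) step.prems by (simp add: step_rep_def)
  then show ?case using step by simp
qed simp

lemma step_rep_sum_eq:
  assumes rep: "step_rep f n \<tau> c" and P: "finite P" "P \<subseteq> {0..1}" "\<tau> ` {..n} \<subseteq> P"
    and D: "\<forall>y\<in>P. w y = (\<Sum>x\<in>P. D x * (if x \<le> y then 1 else 0))"
  shows "(\<Sum>i<n. c i * (w (\<tau> (Suc i)) - w (\<tau> i))) = (\<Sum>x\<in>P - {0}. D x * f x)"
proof -
  have "w (\<tau> (Suc i)) - w (\<tau> i) = (\<Sum>x\<in>P. D x * indicator {\<tau> i<..\<tau> (Suc i)} x)" if "i < n" for i
  proof -
    have "\<tau> (Suc i) \<in> P" "\<tau> i \<in> P" using that P(3) by auto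
    then have "w (\<tau> (Suc i)) - w (\<tau> i) =
        (\<Sum>x\<in>P. D x * (if x \<le> \<tau> (Suc i) then 1 else 0) - D x * (if x \<le> \<tau> i then 1 else 0))"
      using D by (simp add: sum_subtractf)
    also have "\<dots> = (\<Sum>x\<in>P. D x * indicator {\<tau> i<..\<tau> (Suc i)} x)"
      using step_rep_mono[OF rep, of i "Suc i"] that
      by (intro sum.cong) (auto simp: indicator_def)
    finally show ?thesis .
  qed
  then have "(\<Sum>i<n. c i * (w (\<tau> (Suc i)) - w (\<tau> i))) =
      (\<Sum>i<n. \<Sum>x\<in>P. D x * (c i * indicator {\<tau> i<..\<tau> (Suc i)} x))"
    by (auto intro!: sum.cong simp: sum_distrib_left algebra_simps)
  also have "\<dots> = (\<Sum>x\<in>P. D x * (\<Sum>i<n. c i * indicator {\<tau> i<..\<tau> (Suc i)} x))"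
    by (subst sum.swap) (simp only: sum_distrib_left)
  also have "\<dots> = (\<Sum>x\<in>P - {0}. D x * (\<Sum>i<n. c i * indicator {\<tau> i<..\<tau> (Suc i)} x))"
  proof (rule sum.mono_neutral_right)
    have "\<not> \<tau> i < 0" if "i < n" for i
      using step_rep_mono[OF rep, of 0 i] that rep by (auto simp: step_rep_def)
    then show "\<forall>x\<in>P - (P - {0}). D x * (\<Sum>i<n. c i * indicator {\<tau> i<..\<tau> (Suc i)} x) = 0"
      by (auto intro!: sum.neutral simp: indicator_def)
  qed (use P in auto)
  also have "\<dots> = (\<Sum>x\<in>P - {0}. D x * f x)"
  proof (rule sum.cong)
    fix x assume "x \<in> P - {0}"
    then have "x \<in> {0<..1}" using P(2) by force
    then show "D x * (\<Sum>i<n. c i * indicator {\<tau> i<..\<tau> (Suc i)} x) = D x * f x"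
      using rep by (auto simp: step_rep_def)
  qed simp
  finally show ?thesis .
qed

lemma stoch_integral_eq:
  assumes rep: "step_rep f n \<tau> c"
  shows "stoch_integral f w = (\<Sum>i<n. c i * (w (\<tau> (Suc i)) - w (\<tau> i)))"
  unfolding stoch_integral_def
proof (rule the_equality)
  fix I
  assume "\<exists>n \<tau> c. step_rep f n \<tau> c \<and> I = (\<Sum>i<n. c i * (w (\<tau> (Suc i)) - w (\<tau> i)))"
  then obtain m \<sigma> d where rep': "step_rep f m \<sigma> d"
    and I: "I = (\<Sum>i<m. d i * (w (\<sigma> (Suc i)) - w (\<sigma> i)))" by blast
  define P where "P = \<tau> ` {..n} \<union> \<sigma> ` {..m}"
  have "finite P" by (simp add: P_def)
  moreover have "P \<subseteq> {0..1}"
    using step_rep_mono[OF rep, of 0] step_rep_mono[OF rep, of _ n]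
      step_rep_mono[OF rep', of 0] step_rep_mono[OF rep', of _ m] rep rep'
    by (auto simp: P_def step_rep_def)
  moreover obtain D where "\<forall>y\<in>P. w y = (\<Sum>x\<in>P. D x * (if x \<le> y then 1 else 0))"
    using finite_jump_decomposition[OF \<open>finite P\<close>] by blast
  ultimately show "I = (\<Sum>i<n. c i * (w (\<tau> (Suc i)) - w (\<tau> i)))"
    using step_rep_sum_eq[OF rep, of P w D] step_rep_sum_eq[OF rep', of P w D] I
    by (simp add: P_def)
qed (use rep in blast)

lemma stoch_integral_dyadic:
  fixes c :: "nat \<Rightarrow> real"
  shows "stoch_integral (\<lambda>u. \<Sum>k=1..2 ^ s. c k * indicator {(real k - 1) / 2 ^ s<..real k / 2 ^ s} u) w =
    (\<Sum>k=1..2 ^ s. c k * (w (real k / 2 ^ s) - w ((real k - 1) / 2 ^ s)))"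
proof -
  have shift: "(\<Sum>k=1..2 ^ s. g k) = (\<Sum>i<2 ^ s. g (Suc i))" for g :: "nat \<Rightarrow> real"
    by (simp add: sum.atLeast1_atMost_eq)
  have "step_rep (\<lambda>u. \<Sum>k=1..2 ^ s. c k * indicator {(real k - 1) / 2 ^ s<..real k / 2 ^ s} u)
      (2 ^ s) (\<lambda>i. real i / 2 ^ s) (\<lambda>i. c (Suc i))"
    unfolding step_rep_def shift by (auto simp: divide_strict_right_mono)
  from stoch_integral_eq[OF this, of w] show ?thesis unfolding shift by simp
qed


section \<open>Polynomial functionals\<close>

text \<open>
  The density of \<open>\<sigma>\<^sub>k\<^sup>s\<close>. An element \<open>h\<close> of the Cameron-Martin space enters \<open>[h]\<close> only through
  its density, so \<open>[\<sigma>\<^sub>k\<^sup>s](w)\<close> is \<open>stoch_integral (sigma_dot s k) w\<close>.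
\<close>

definition sigma_dot :: "nat \<Rightarrow> nat \<Rightarrow> real \<Rightarrow> real" where
  "sigma_dot s k u =
     2 powr (real s / 2) * indicator {(real k - 1) / 2 ^ s<..real k / 2 ^ s} u"

lemma stoch_integral_sigma_dot:
  assumes "k \<in> {1..2 ^ s}"
  shows "stoch_integral (sigma_dot s k) w =
    2 powr (real s / 2) * (w (real k / 2 ^ s) - w ((real k - 1) / 2 ^ s))"
proof -
  let ?c = "\<lambda>j. if j = k then 2 powr (real s / 2) else (0::real)"
  have pick: "(\<Sum>j=1..2 ^ s. ?c j * g j) = 2 powr (real s / 2) * g k" for g :: "nat \<Rightarrow> real"
  proof -
    have "(\<Sum>j=1..2 ^ s. ?c j * g j) = (\<Sum>j=1..2 ^ s. if j = k then 2 powr (real s / 2) * g j else 0)"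
      by (rule sum.cong) auto
    then show ?thesis using assms by (simp only: sum.delta finite_atLeastAtMost if_True)
  qed
  have "sigma_dot s k =
      (\<lambda>u. \<Sum>j=1..2 ^ s. ?c j * indicator {(real j - 1) / 2 ^ s<..real j / 2 ^ s} u)"
    unfolding pick sigma_dot_def by (rule ext) simp
  then have "stoch_integral (sigma_dot s k) w =
      (\<Sum>j=1..2 ^ s. ?c j * (w (real j / 2 ^ s) - w ((real j - 1) / 2 ^ s)))"
    by (simp only: stoch_integral_dyadic)
  then show ?thesis by (simp only: pick)
qed

text \<open>
  Polynomials in finitely many of the \<open>[\<sigma>\<^sub>k\<^sup>s]\<close>, of arbitrary and possibly different levels \<open>s\<close>:
  the algebra of functionals generated by them. Every \<open>[\<sigma>\<^sub>k\<^sup>s]\<close> is defined for every path, so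
  no choice of versions is involved when a functional is evaluated at a shifted path.
\<close>

inductive_set polynomial_functionals :: "((real \<Rightarrow> real) \<Rightarrow> real) set" where
  const: "(\<lambda>_. a) \<in> polynomial_functionals"
| sigma: "k \<in> {1..2 ^ s} \<Longrightarrow> (\<lambda>w. stoch_integral (sigma_dot s k) w) \<in> polynomial_functionals"
| add: "F \<in> polynomial_functionals \<Longrightarrow> G \<in> polynomial_functionals \<Longrightarrow>
    (\<lambda>w. F w + G w) \<in> polynomial_functionals"
| mult: "F \<in> polynomial_functionals \<Longrightarrow> G \<in> polynomial_functionals \<Longrightarrow>
    (\<lambda>w. F w * G w) \<in> polynomial_functionals"


section \<open>Simple predictable processes\<close>

definition simple_predictable ::
  "nat \<Rightarrow> (nat \<Rightarrow> (real \<Rightarrow> real) \<Rightarrow> real) \<Rightarrow> ((real \<Rightarrow> real) \<Rightarrow> real \<Rightarrow> real) \<Rightarrow> bool" where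
  "simple_predictable s \<zeta> z \<longleftrightarrow>
     (\<forall>k\<in>{1..2 ^ s}. \<zeta> k \<in> borel_measurable (wiener_filtration ((real k - 1) / 2 ^ s))) \<and>
     (\<forall>w t. z w t = (\<Sum>k=1..2 ^ s. 2 powr (real s / 2) * \<zeta> k w *
        indicator {(real k - 1) / 2 ^ s<..real k / 2 ^ s} t))"

definition drift_shift ::
  "((real \<Rightarrow> real) \<Rightarrow> real \<Rightarrow> real) \<Rightarrow> (real \<Rightarrow> real) \<Rightarrow> real \<Rightarrow> real" where
  "drift_shift z w = (\<lambda>t\<in>{0..1}. w t - (LINT u:{0..t}|lborel. z w u))"

end

theory Submission
  imports Defs
begin

text \<open>
  A polynomial functional depends on finitely many dyadic increments. Choose a level \<open>m\<close>, at
  least \<open>s\<close>, that resolves all of them. On each interval of level \<open>m\<close> the process \<open>z\<close> is constant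
  in time with a value \<open>a\<^sub>j\<close> known at the left end point, so the shift replaces the increment \<open>X\<^sub>j\<close>
  by \<open>X\<^sub>j - a\<^sub>j v\<close>, where \<open>v = 2\<^sup>-\<^sup>m\<close>, and the exponent is the sum of the \<open>a\<^sub>j X\<^sub>j - a\<^sub>j\<^sup>2 v / 2\<close>. Given the
  past, \<open>X\<^sub>j\<close> is centred normal with variance \<open>v\<close>, and the factor \<open>exp (a\<^sub>j X\<^sub>j - a\<^sub>j\<^sup>2 v / 2)\<close> exactly
  undoes the translation by \<open>a\<^sub>j v\<close>. Integrating out the increments from the last one backwards
  shows that the shifted increments have, under the weighted measure, the law of the original
  ones. Working with non-negative integrands makes this valid without any integrability
  assumption on \<open>z\<close>.
\<close>

section \<open>Discrete Girsanov transformation for Gaussian increments\<close>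

text \<open>Completing the square, -x^2/(2v) + a x - a^2 v/2 = -(x - a v)^2/(2v), so the exponential
  moves the centre of the density from 0 to \<open>a * v\<close>. Translation invariance of Lebesgue
  measure then removes the shift.\<close>

lemma nn_integral_normal_shift:
  fixes h :: "real \<Rightarrow> ennreal"
  assumes [measurable]: "h \<in> borel_measurable borel" and "0 < v"
  shows "(\<integral>\<^sup>+x. h (x - a * v) * ennreal (exp (a * x - a\<^sup>2 * v / 2)) \<partial>density lborel (normal_density 0 (sqrt v)))
    = (\<integral>\<^sup>+x. h x \<partial>density lborel (normal_density 0 (sqrt v)))"
proof -
  have tilt: "normal_density 0 (sqrt v) x * exp (a * x - a\<^sup>2 * v / 2) = normal_density 0 (sqrt v) (x - a * v)" for x
  proof -
    have "exp (- x\<^sup>2 / (2 * v)) * exp (a * x - a\<^sup>2 * v / 2) = exp (- (x - a * v)\<^sup>2 / (2 * v))"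
      unfolding exp_add[symmetric]
      using \<open>0 < v\<close> by (intro arg_cong[where f = exp]) (simp add: field_simps power2_eq_square)
    then show ?thesis
      using \<open>0 < v\<close> by (simp add: normal_density_def)
  qed
  have "(\<integral>\<^sup>+x. h (x - a * v) * ennreal (exp (a * x - a\<^sup>2 * v / 2)) \<partial>density lborel (normal_density 0 (sqrt v)))
    = (\<integral>\<^sup>+x. ennreal (normal_density 0 (sqrt v) (x - a * v)) * h (x - a * v) \<partial>lborel)"
    by (subst nn_integral_density)
      (auto intro!: nn_integral_cong simp: tilt[symmetric] ennreal_mult mult_ac)
  also have "\<dots> = (\<integral>\<^sup>+x. ennreal (normal_density 0 (sqrt v) x) * h x \<partial>lborel)"
    by (subst nn_integral_real_affine[where c = 1 and t = "a * v"]) (auto simp: one_ennreal_def[symmetric])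
  also have "\<dots> = (\<integral>\<^sup>+x. h x \<partial>density lborel (normal_density 0 (sqrt v)))"
    by (subst nn_integral_density) auto
  finally show ?thesis .
qed

text \<open>The library's \<open>indep_var\<close> requires both variables to take values in the same type, hence the
  direct formulation.\<close>

definition (in prob_space) indep_of :: "'a measure \<Rightarrow> 'b measure \<Rightarrow> ('a \<Rightarrow> 'b) \<Rightarrow> bool" where
  "indep_of N L X \<longleftrightarrow> subalgebra M N \<and> X \<in> measurable M L \<and>
    indep_set (sets N) {X -` B \<inter> space M | B. B \<in> sets L}"

text \<open>Plays the part of conditioning on \<open>N\<close>. By independence the law of
  \<open>(w, X w)\<close> on \<open>N \<Otimes>\<^sub>M L\<close> is the product of \<open>M\<close>
  restricted to \<open>N\<close> and the law of \<open>X\<close>, and Tonelli gives the iterated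
  integral. As the first coordinate is the sample point itself, \<open>f\<close> may involve any
  number of \<open>N\<close>-measurable quantities.\<close>

lemma (in prob_space) nn_integral_indep_of:
  assumes ind: "indep_of N L X"
    and [measurable]: "f \<in> borel_measurable (N \<Otimes>\<^sub>M L)"
  shows "(\<integral>\<^sup>+w. f (w, X w) \<partial>M) = (\<integral>\<^sup>+w. \<integral>\<^sup>+x. f (w, x) \<partial>distr M L X \<partial>M)"
proof -
  have N: "subalgebra M N" and [measurable]: "X \<in> measurable M L"
    using ind by (auto simp: indep_of_def)
  have id[measurable]: "(\<lambda>w. w) \<in> measurable M N"
    using N by (auto simp: subalgebra_def measurable_def)
  interpret X: prob_space "distr M L X" by (rule prob_space_distr) simp
  interpret N: prob_space "distr M N (\<lambda>w. w)" by (rule prob_space_distr) simp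
  have "distr M N (\<lambda>w. w) \<Otimes>\<^sub>M distr M L X = distr M (N \<Otimes>\<^sub>M L) (\<lambda>w. (w, X w))"
  proof (rule pair_measure_eqI)
    fix A B assume "A \<in> sets (distr M N (\<lambda>w. w))" "B \<in> sets (distr M L X)"
    then have A[measurable]: "A \<in> sets N" and B[measurable]: "B \<in> sets L" by auto
    have "A \<in> sets M" using N A by (auto simp: subalgebra_def)
    then have [simp]: "A \<inter> space M = A" using sets.sets_into_space by auto
    have "prob (A \<inter> (X -` B \<inter> space M)) = prob A * prob (X -` B \<inter> space M)"
      using ind A B unfolding indep_of_def indep_sets2_eq by blast
    moreover have "(\<lambda>w. (w, X w)) -` (A \<times> B) \<inter> space M = A \<inter> (X -` B \<inter> space M)"
      using \<open>A \<inter> space M = A\<close> by auto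
    ultimately show "emeasure (distr M N (\<lambda>w. w)) A * emeasure (distr M L X) B =
        emeasure (distr M (N \<Otimes>\<^sub>M L) (\<lambda>w. (w, X w))) (A \<times> B)"
      using \<open>A \<inter> space M = A\<close> by (simp add: emeasure_distr emeasure_eq_measure ennreal_mult)
  qed (auto simp: N.sigma_finite_measure_axioms X.sigma_finite_measure_axioms cong: sets_pair_measure_cong)
  then have "(\<integral>\<^sup>+w. f (w, X w) \<partial>M) = (\<integral>\<^sup>+p. f p \<partial>(distr M N (\<lambda>w. w) \<Otimes>\<^sub>M distr M L X))"
    by (simp add: nn_integral_distr)
  also have "\<dots> = (\<integral>\<^sup>+w. \<integral>\<^sup>+x. f (w, x) \<partial>distr M L X \<partial>distr M N (\<lambda>w. w))"
    by (rule X.nn_integral_fst[symmetric]) simp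
  also have "\<dots> = (\<integral>\<^sup>+w. \<integral>\<^sup>+x. f (w, x) \<partial>distr M L X \<partial>M)"
    by (subst nn_integral_distr) auto
  finally show ?thesis .
qed

text \<open>Padding with zeros puts vectors of every length into one space of sequences, so that an
  induction on the length can keep the type and domain of its test functions.\<close>

lemma truncated_sequence_measurable:
  assumes "\<And>j. j < n \<Longrightarrow> Y j \<in> borel_measurable N"
  shows "(\<lambda>w j. if j < n then Y j w else (0::real)) \<in> measurable N (Pi\<^sub>M UNIV (\<lambda>_::nat. borel))"
proof (rule measurable_PiM_single')
  show "(\<lambda>w. if j < n then Y j w else 0) \<in> borel_measurable N" for j
    using assms by (cases "j < n") auto
qed auto

text \<open>Here \<open>\<F> n\<close> is the past of step \<open>n\<close>: it knows the earlier
  increments and the coefficients up to and including \<open>a n\<close>, and is independent of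
  \<open>X n\<close>. The induction integrates out \<open>X n\<close> with this past frozen, which
  replaces the test function by an average of it; hence \<open>g\<close> is arbitrary.\<close>

lemma (in prob_space) gaussian_girsanov:
  fixes \<F> :: "nat \<Rightarrow> 'a measure" and X a :: "nat \<Rightarrow> 'a \<Rightarrow> real"
  assumes "0 < v"
    and X: "\<And>n. n < m \<Longrightarrow> distributed M lborel (X n) (normal_density 0 (sqrt v))"
    and ind: "\<And>n. n < m \<Longrightarrow> indep_of (\<F> n) borel (X n)"
    and X\<F>: "\<And>j n. j < n \<Longrightarrow> n < m \<Longrightarrow> X j \<in> borel_measurable (\<F> n)"
    and a\<F>: "\<And>j n. j \<le> n \<Longrightarrow> n < m \<Longrightarrow> a j \<in> borel_measurable (\<F> n)"
    and "n \<le> m"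
    and g: "g \<in> borel_measurable (Pi\<^sub>M UNIV (\<lambda>_::nat. borel))"
  shows "(\<integral>\<^sup>+w. g (\<lambda>j. if j < n then X j w - a j w * v else 0) *
        ennreal (exp (\<Sum>j<n. a j w * X j w - (a j w)\<^sup>2 * v / 2)) \<partial>M)
    = (\<integral>\<^sup>+w. g (\<lambda>j. if j < n then X j w else 0) \<partial>M)"
  using \<open>n \<le> m\<close> g
proof (induction n arbitrary: g)
  case 0
  then show ?case by (simp add: emeasure_space_1)
next
  case (Suc n)
  define U where "U w = (\<lambda>j. if j < n then X j w - a j w * v else 0)" for w
  define V where "V w = (\<lambda>j. if j < n then X j w else 0)" for w
  define E where "E w = exp (\<Sum>j<n. a j w * X j w - (a j w)\<^sup>2 * v / 2)" for w
  define \<mu> where "\<mu> = density lborel (\<lambda>x. ennreal (normal_density 0 (sqrt v) x))"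
  \<comment> \<open>The average of \<open>g\<close> over coordinate \<open>n\<close>, the test
    function handed to the induction hypothesis.\<close>
  define g' where "g' y = (\<integral>\<^sup>+x. g (y(n := x)) \<partial>\<mu>)" for y
  have n: "n < m" using Suc.prems by simp
  note [measurable] = Suc.prems(2)
  have \<mu>: "distr M borel (X n) = \<mu>"
    using distributed_distr_eq_density[OF X[OF n]] by (simp add: \<mu>_def cong: distr_cong)
  have [measurable_cong]: "sets \<mu> = sets borel" by (simp add: \<mu>_def)
  interpret \<mu>: prob_space \<mu>
    unfolding \<mu>[symmetric] using ind[OF n] by (auto simp: indep_of_def intro: prob_space_distr)
  have [measurable]: "X j \<in> borel_measurable (\<F> n)" if "j < n" for j using that X\<F> n by simp
  have [measurable]: "a j \<in> borel_measurable (\<F> n)" if "j \<le> n" for j using that a\<F> n by simp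
  have [measurable]: "a n \<in> borel_measurable (\<F> n)" using a\<F> n by simp
  have U[measurable]: "U \<in> measurable (\<F> n) (Pi\<^sub>M UNIV (\<lambda>_. borel))"
    unfolding U_def by (rule truncated_sequence_measurable) simp
  have V[measurable]: "V \<in> measurable (\<F> n) (Pi\<^sub>M UNIV (\<lambda>_. borel))"
    unfolding V_def by (rule truncated_sequence_measurable) simp
  have E[measurable]: "E \<in> borel_measurable (\<F> n)"
    unfolding E_def by (intro borel_measurable_exp[THEN measurable_compose_rev] borel_measurable_sum) auto
  have upd[measurable]: "(\<lambda>(y, x). y(n := x)) \<in> measurable (Pi\<^sub>M UNIV (\<lambda>_. borel) \<Otimes>\<^sub>M borel) (Pi\<^sub>M UNIV (\<lambda>_::nat. borel :: real measure))"
    using measurable_add_dim[of n UNIV "\<lambda>_. borel :: real measure"] by (simp add: insert_UNIV)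
  have g_upd[measurable]: "(\<lambda>x. g (y(n := x))) \<in> borel_measurable borel" for y
    by (intro measurable_compose[OF _ Suc.prems(2)] measurable_fun_upd[where J = UNIV]) (auto simp: space_PiM)
  have g'[measurable]: "g' \<in> borel_measurable (Pi\<^sub>M UNIV (\<lambda>_. borel))"
    unfolding g'_def by measurable
  \<comment> \<open>Coordinate \<open>n\<close> of \<open>U w\<close> and \<open>V w\<close> is
    still the padding 0, so the update puts the newest increment there.\<close>
  have UV: "(\<lambda>j. if j < Suc n then X j w - a j w * v else 0) = (U w)(n := X n w - a n w * v)"
    "(\<lambda>j. if j < Suc n then X j w else 0) = (V w)(n := X n w)" for w
    by (auto simp: U_def V_def fun_eq_iff less_Suc_eq)
  have "(\<integral>\<^sup>+w. g (\<lambda>j. if j < Suc n then X j w - a j w * v else 0) *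
        ennreal (exp (\<Sum>j<Suc n. a j w * X j w - (a j w)\<^sup>2 * v / 2)) \<partial>M)
    = (\<integral>\<^sup>+w. (\<lambda>(w, x). ennreal (E w) * (g ((U w)(n := x - a n w * v)) *
        ennreal (exp (a n w * x - (a n w)\<^sup>2 * v / 2)))) (w, X n w) \<partial>M)"
    unfolding UV by (simp add: E_def exp_add ennreal_mult mult_ac)
  also have "\<dots> = (\<integral>\<^sup>+w. \<integral>\<^sup>+x. ennreal (E w) * (g ((U w)(n := x - a n w * v)) *
        ennreal (exp (a n w * x - (a n w)\<^sup>2 * v / 2))) \<partial>\<mu> \<partial>M)"
    using nn_integral_indep_of[OF ind[OF n], of "\<lambda>(w, x). ennreal (E w) * (g ((U w)(n := x - a n w * v)) *
        ennreal (exp (a n w * x - (a n w)\<^sup>2 * v / 2)))"]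
    unfolding \<mu> by simp
  also have "\<dots> = (\<integral>\<^sup>+w. g' (U w) * ennreal (E w) \<partial>M)"
  proof (rule nn_integral_cong)
    fix w assume "w \<in> space M"
    have "(\<integral>\<^sup>+x. ennreal (E w) * (g ((U w)(n := x - a n w * v)) *
        ennreal (exp (a n w * x - (a n w)\<^sup>2 * v / 2))) \<partial>\<mu>) =
      ennreal (E w) * (\<integral>\<^sup>+x. g ((U w)(n := x - a n w * v)) *
        ennreal (exp (a n w * x - (a n w)\<^sup>2 * v / 2)) \<partial>\<mu>)"
      by (rule nn_integral_cmult)
        (intro borel_measurable_times_ennreal measurable_compose[OF _ g_upd], auto)
    \<comment> \<open>With \<open>w\<close> fixed, \<open>a n w\<close> is a constant, so the
      one-dimensional shift applies.\<close>
    also have "\<dots> = ennreal (E w) * g' (U w)"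
      unfolding \<mu>_def g'_def
      using nn_integral_normal_shift[of "\<lambda>x. g ((U w)(n := x))", OF _ \<open>0 < v\<close>, of "a n w"] by simp
    finally show "(\<integral>\<^sup>+x. ennreal (E w) * (g ((U w)(n := x - a n w * v)) *
        ennreal (exp (a n w * x - (a n w)\<^sup>2 * v / 2))) \<partial>\<mu>) = g' (U w) * ennreal (E w)"
      by (simp add: mult.commute)
  qed
  also have "\<dots> = (\<integral>\<^sup>+w. g' (V w) \<partial>M)"
    using Suc.IH[of g'] n g' by (simp add: U_def V_def E_def)
  \<comment> \<open>Independence is used a second time, backwards, to turn the average over
    \<open>\<mu>\<close> into the increment \<open>X n\<close>.\<close>
  also have "\<dots> = (\<integral>\<^sup>+w. (\<lambda>(w, x). g ((V w)(n := x))) (w, X n w) \<partial>M)"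
    using nn_integral_indep_of[OF ind[OF n], of "\<lambda>(w, x). g ((V w)(n := x))"]
    unfolding \<mu> by (simp add: g'_def)
  finally show ?case unfolding UV by simp
qed

text \<open>Indicators as test functions turn the integral identity into an equality of laws. In
  this form it carries over both integrability and integrals of signed functions.\<close>

lemma (in prob_space) gaussian_girsanov_distr:
  fixes \<F> :: "nat \<Rightarrow> 'a measure" and X a :: "nat \<Rightarrow> 'a \<Rightarrow> real"
  assumes "0 < v"
    and X: "\<And>n. n < m \<Longrightarrow> distributed M lborel (X n) (normal_density 0 (sqrt v))"
    and ind: "\<And>n. n < m \<Longrightarrow> indep_of (\<F> n) borel (X n)"
    and X\<F>: "\<And>j n. j < n \<Longrightarrow> n < m \<Longrightarrow> X j \<in> borel_measurable (\<F> n)"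
    and a\<F>: "\<And>j n. j \<le> n \<Longrightarrow> n < m \<Longrightarrow> a j \<in> borel_measurable (\<F> n)"
  defines "E \<equiv> \<lambda>w. exp (\<Sum>j<m. a j w * X j w - (a j w)\<^sup>2 * v / 2)"
    and "U \<equiv> \<lambda>w j. if j < m then X j w - a j w * v else 0"
    and "V \<equiv> \<lambda>w j. if j < m then X j w else 0"
  shows "E \<in> borel_measurable M"
    and "U \<in> measurable M (Pi\<^sub>M UNIV (\<lambda>_. borel))"
    and "V \<in> measurable M (Pi\<^sub>M UNIV (\<lambda>_. borel))"
    and "distr (density M E) (Pi\<^sub>M UNIV (\<lambda>_. borel)) U = distr M (Pi\<^sub>M UNIV (\<lambda>_. borel)) V"
proof -
  let ?P = "Pi\<^sub>M UNIV (\<lambda>_::nat. borel :: real measure)"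
  have [measurable]: "X j \<in> borel_measurable M" if "j < m" for j
    using ind[OF that] by (simp add: indep_of_def)
  have [measurable]: "a j \<in> borel_measurable M" if "j < m" for j
    using measurable_from_subalg[of M "\<F> j" "a j" borel] ind[OF that] a\<F>[of j j] that
    by (simp add: indep_of_def)
  show E[measurable]: "E \<in> borel_measurable M"
    unfolding E_def by (rule borel_measurable_exp[THEN measurable_compose_rev]) (rule borel_measurable_sum, simp)
  show U[measurable]: "U \<in> measurable M ?P"
    unfolding U_def by (rule truncated_sequence_measurable) simp
  show V[measurable]: "V \<in> measurable M ?P"
    unfolding V_def by (rule truncated_sequence_measurable) simp
  show "distr (density M E) ?P U = distr M ?P V"
  proof (rule measure_eqI)
    fix A assume "A \<in> sets (distr (density M E) ?P U)"
    then have A[measurable]: "A \<in> sets ?P" by simp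
    have "emeasure (distr (density M E) ?P U) A = (\<integral>\<^sup>+w. indicator A (U w) * ennreal (E w) \<partial>M)"
      by (subst emeasure_distr, simp, simp, subst emeasure_density)
        (auto intro!: nn_integral_cong simp: indicator_def)
    also have "\<dots> = (\<integral>\<^sup>+w. indicator A (V w) \<partial>M)"
      unfolding E_def U_def V_def
      by (rule gaussian_girsanov[OF \<open>0 < v\<close> X ind X\<F> a\<F> order_refl]) simp_all
    also have "\<dots> = emeasure (distr M ?P V) A"
      by (subst nn_integral_distr[symmetric, where M' = ?P]) simp_all
    finally show "emeasure (distr (density M E) ?P U) A = emeasure (distr M ?P V) A" .
  qed simp
qed

section \<open>Independence of Wiener increments from the past\<close>

lemma space_wiener_measure:
  assumes "wiener_measure \<gamma>"
  shows "space \<gamma> = wiener_space"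
proof -
  have "sets \<gamma> = sets wiener_borel"
    using assms by (simp add: wiener_measure_def)
  from sets_eq_imp_space_eq[OF this] show ?thesis
    by (simp add: wiener_borel_def space_measure_of_conv)
qed

lemma wiener_increment_distributed:
  assumes "wiener_measure \<gamma>" "0 \<le> s" "s < t" "t \<le> 1"
  shows "distributed \<gamma> lborel (\<lambda>w. w t - w s) (normal_density 0 (sqrt (t - s)))"
  using assms by (simp only: wiener_measure_def)

text \<open>Paths start at 0, so \<open>w t\<close> is the increment from time 0, and measurability
  is part of its having a density. Time 0 is separate because the density clause asks for
  \<open>s < t\<close>; there the evaluation is constant.\<close>

lemma wiener_evaluation_measurable:
  assumes \<gamma>: "wiener_measure \<gamma>" and "t \<in> {0..1}"
  shows "(\<lambda>w. w t) \<in> borel_measurable \<gamma>"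
proof (cases "t = 0")
  case True
  then show ?thesis
    by (subst measurable_cong[where g = "\<lambda>_. 0"])
      (auto simp: space_wiener_measure[OF \<gamma>] wiener_space_iff)
next
  case False
  then have "distributed \<gamma> lborel (\<lambda>w. w t - w 0) (normal_density 0 (sqrt (t - 0)))"
    using \<open>t \<in> {0..1}\<close> by (intro wiener_increment_distributed[OF \<gamma>]) auto
  then have "(\<lambda>w. w t - w 0) \<in> borel_measurable \<gamma>"
    by (simp add: distributed_def)
  then show ?thesis
    by (subst measurable_cong[where g = "\<lambda>w. w t - w 0"])
      (auto simp: space_wiener_measure[OF \<gamma>] wiener_space_iff)
qed

lemma space_wiener_filtration [simp]: "space (wiener_filtration t) = wiener_space"
  by (simp add: wiener_filtration_def space_measure_of_conv)

lemma sets_wiener_filtration: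
  "sets (wiener_filtration t) =
    sigma_sets wiener_space {{w \<in> wiener_space. w u \<in> B} | u B. u \<in> {0..t} \<and> B \<in> sets borel}"
  unfolding wiener_filtration_def by (rule sets_measure_of) blast

lemma wiener_filtration_mono:
  assumes "t \<le> t'"
  shows "sets (wiener_filtration t) \<subseteq> sets (wiener_filtration t')"
  unfolding sets_wiener_filtration using assms by (intro sigma_sets_mono') (blast intro: atLeastAtMost_iff[THEN iffD2] order_trans dest: atLeastAtMost_iff[THEN iffD1])

lemma borel_measurable_wiener_filtration_mono:
  assumes "f \<in> borel_measurable (wiener_filtration t)" "t \<le> t'"
  shows "f \<in> borel_measurable (wiener_filtration t')"
  using assms wiener_filtration_mono[of t t'] by (auto simp: measurable_def)

lemma wiener_filtration_evaluation_measurable: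
  assumes "u \<in> {0..t}"
  shows "(\<lambda>w. w u) \<in> borel_measurable (wiener_filtration t)"
proof (rule measurableI)
  fix B :: "real set" assume "B \<in> sets borel"
  then have "{w \<in> wiener_space. w u \<in> B} \<in> sets (wiener_filtration t)"
    unfolding sets_wiener_filtration using assms by (intro sigma_sets.Basic) blast
  then show "(\<lambda>w. w u) -` B \<inter> space (wiener_filtration t) \<in> sets (wiener_filtration t)"
    by (simp add: vimage_def Int_def conj_commute)
qed simp

lemma subalgebra_wiener_filtration:
  assumes \<gamma>: "wiener_measure \<gamma>" and "t \<le> 1"
  shows "subalgebra \<gamma> (wiener_filtration t)"
proof -
  have "{{w \<in> space \<gamma>. w u \<in> B} | u B. u \<in> {0..t} \<and> B \<in> sets borel} \<subseteq> sets \<gamma>"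
  proof
    fix A assume "A \<in> {{w \<in> space \<gamma>. w u \<in> B} | u B. u \<in> {0..t} \<and> B \<in> sets borel}"
    then obtain u B where "A = {w \<in> space \<gamma>. w u \<in> B}" "u \<in> {0..t}" "B \<in> sets borel"
      by blast
    then have "A = (\<lambda>w. w u) -` B \<inter> space \<gamma>" "u \<in> {0..1}" "B \<in> sets borel"
      using \<open>t \<le> 1\<close> by auto
    then show "A \<in> sets \<gamma>"
      using measurable_sets[OF wiener_evaluation_measurable[OF \<gamma>]] by blast
  qed
  from sets.sigma_sets_subset[OF this] show ?thesis
    by (simp add: subalgebra_def sets_wiener_filtration space_wiener_measure[OF \<gamma>])
qed

text \<open>Adding \<open>0\<close> and \<open>t\<close> to the finitely many times in \<open>U\<close> and then appending \<open>t'\<close> gives a grid along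
  which the increments are independent; the cylinder set \<open>A\<close> depends on all but the last of them.\<close>

lemma wiener_cylinder_increment_indep:
  fixes B :: "real \<Rightarrow> real set"
  assumes \<gamma>: "wiener_measure \<gamma>" and t: "0 \<le> t" "t < t'" "t' \<le> 1"
    and U: "finite U" "U \<subseteq> {0..t}"
    and B: "\<And>u. B u \<in> sets borel" and C: "C \<in> sets borel"
  defines "A \<equiv> {w \<in> space \<gamma>. \<forall>u\<in>U. w u \<in> B u}"
    and "D \<equiv> (\<lambda>w. w t' - w t) -` C \<inter> space \<gamma>"
  shows "A \<in> sets \<gamma>" "measure \<gamma> (A \<inter> D) = measure \<gamma> A * measure \<gamma> D"
proof -
  interpret prob_space \<gamma> using \<gamma> by (simp add: wiener_measure_def)
  define xs where "xs = sorted_list_of_set (insert 0 (insert t U))"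
  define n where "n = length xs - 1"
  define \<tau> where "\<tau> i = (xs @ [t']) ! i" for i
  have xs: "set xs = insert 0 (insert t U)" "sorted_wrt (<) xs"
    unfolding xs_def using U by (simp_all del: sorted_list_of_set_insert_remove)
  have len: "length xs = Suc n"
    using xs by (cases xs) (auto simp: n_def)
  have \<tau>_xs: "\<tau> i = xs ! i" if "i \<le> n" for i
    using that len by (simp add: \<tau>_def nth_append)
  have \<tau>_last: "\<tau> (Suc n) = t'"
    using len by (simp add: \<tau>_def nth_append)
  have \<tau>_le_t: "\<tau> i \<le> t" "0 \<le> \<tau> i" if "i \<le> n" for i
    using \<tau>_xs[OF that] nth_mem[of i xs] that len xs(1) U t by auto
  have strict: "\<tau> i < \<tau> j" if "i < j" "j \<le> n" for i j
    using sorted_wrt_nth_less[OF xs(2) that(1)] that len by (simp add: \<tau>_xs)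
  \<comment> \<open>The point \<open>t\<close> occurs in the list, and all entries are at most
    \<open>t\<close>; strict monotonicity leaves only the last index. The argument for
    \<open>\<tau> 0 = 0\<close> is the mirror image.\<close>
  have \<tau>_n: "\<tau> n = t"
  proof -
    have "t \<in> set xs" by (simp add: xs)
    then obtain i where "i \<le> n" "\<tau> i = t"
      using len \<tau>_xs by (auto simp: in_set_conv_nth less_Suc_eq_le)
    then show ?thesis
      using strict[of i n] \<tau>_le_t[of n] by (cases "i = n") auto
  qed
  have \<tau>_0: "\<tau> 0 = 0"
  proof -
    have "0 \<in> set xs" by (simp add: xs)
    then obtain i where "i \<le> n" "\<tau> i = 0"
      using len \<tau>_xs by (auto simp: in_set_conv_nth less_Suc_eq_le)
    then show ?thesis
      using strict[of 0 i] \<tau>_le_t[of 0] by (cases "i = 0") auto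
  qed
  have "\<forall>i<Suc n. \<tau> i < \<tau> (Suc i)"
    using strict \<tau>_last \<tau>_n t by (auto simp: less_Suc_eq)
  then have ind: "indep_vars (\<lambda>_. borel) (\<lambda>i w. w (\<tau> (Suc i)) - w (\<tau> i)) {..<Suc n}"
    using \<gamma> \<tau>_0 \<tau>_last t unfolding wiener_measure_def by simp
  \<comment> \<open>\<open>V\<close> collects the increments up to time \<open>t\<close> and
    \<open>W\<close> is the single one from \<open>t\<close> to \<open>t'\<close>. Their index sets
    are disjoint, whence independence.\<close>
  define V where "V w = (\<lambda>i\<in>{..<n}. w (\<tau> (Suc i)) - w (\<tau> i))" for w :: "real \<Rightarrow> real"
  define W where "W w = (\<lambda>i\<in>{n}. w (\<tau> (Suc i)) - w (\<tau> i))" for w :: "real \<Rightarrow> real"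
  have VW: "indep_var (Pi\<^sub>M {..<n} (\<lambda>_. borel)) V (Pi\<^sub>M {n} (\<lambda>_. borel)) W"
    unfolding V_def W_def by (rule indep_var_restrict[OF ind]) auto
  \<comment> \<open>The cylinder condition in terms of increments: as \<open>w 0 = 0\<close>, the
    first \<open>i\<close> of them add up to \<open>w (\<tau> i)\<close>.\<close>
  define A' where "A' = {y \<in> space (Pi\<^sub>M {..<n} (\<lambda>_. borel)). \<forall>i\<in>{i. i \<le> n \<and> \<tau> i \<in> U}. (\<Sum>j<i. y j) \<in> B (\<tau> i)}"
  define D' where "D' = {y \<in> space (Pi\<^sub>M {n} (\<lambda>_. borel)). y n \<in> C}"
  have A': "A' \<in> sets (Pi\<^sub>M {..<n} (\<lambda>_. borel))"
    unfolding A'_def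
  proof (rule sets.sets_Collect_finite_All)
    fix i assume "i \<in> {i. i \<le> n \<and> \<tau> i \<in> U}"
    then have "(\<lambda>y. \<Sum>j<i. y j :: real) \<in> borel_measurable (Pi\<^sub>M {..<n} (\<lambda>_. borel))"
      by - (rule borel_measurable_sum, rule measurable_component_singleton, auto)
    from measurable_sets[OF this B[of "\<tau> i"]]
    show "{y \<in> space (Pi\<^sub>M {..<n} (\<lambda>_. borel)). (\<Sum>j<i. y j) \<in> B (\<tau> i)} \<in> sets (Pi\<^sub>M {..<n} (\<lambda>_. borel))"
      by (simp add: vimage_def Int_def conj_commute)
  qed auto
  have D': "D' \<in> sets (Pi\<^sub>M {n} (\<lambda>_. borel))"
    using measurable_sets[OF measurable_component_singleton[of n "{n}" "\<lambda>_. borel"] C]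
    by (simp add: D'_def vimage_def Int_def conj_commute)
  have partial_sum: "(\<Sum>j<i. V w j) = w (\<tau> i)" if "w \<in> space \<gamma>" "i \<le> n" for w i
  proof -
    have "(\<Sum>j<i. V w j) = (\<Sum>j<i. w (\<tau> (Suc j)) - w (\<tau> j))"
      using that by (intro sum.cong) (auto simp: V_def)
    also have "\<dots> = w (\<tau> i) - w (\<tau> 0)" by (rule sum_lessThan_telescope)
    finally show ?thesis
      using that by (simp add: \<tau>_0 space_wiener_measure[OF \<gamma>] wiener_space_iff)
  qed
  have grid: "\<exists>i\<le>n. \<tau> i = u" if "u \<in> U" for u
  proof -
    have "u \<in> set xs" using that by (simp add: xs)
    then show ?thesis
      using len \<tau>_xs by (auto simp: in_set_conv_nth less_Suc_eq_le)
  qed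
  have "V w \<in> A' \<longleftrightarrow> (\<forall>u\<in>U. w u \<in> B u)" if "w \<in> space \<gamma>" for w
  proof -
    have "V w \<in> space (Pi\<^sub>M {..<n} (\<lambda>_. borel))" by (simp add: V_def space_PiM)
    then have "V w \<in> A' \<longleftrightarrow> (\<forall>i\<in>{i. i \<le> n \<and> \<tau> i \<in> U}. w (\<tau> i) \<in> B (\<tau> i))"
      using partial_sum[OF that] by (auto simp: A'_def)
    also have "\<dots> \<longleftrightarrow> (\<forall>u\<in>U. w u \<in> B u)" using grid by blast
    finally show ?thesis .
  qed
  then have A_eq: "A = V -` A' \<inter> space \<gamma>"
    by (auto simp: A_def)
  have D_eq: "D = W -` D' \<inter> space \<gamma>"
    by (auto simp: D_def D'_def W_def space_PiM \<tau>_last \<tau>_n)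
  have AD: "A \<inter> D = (\<lambda>w. (V w, W w)) -` (A' \<times> D') \<inter> space \<gamma>"
    unfolding A_eq D_eq by auto
  show "A \<in> sets \<gamma>"
    unfolding A_eq by (rule measurable_sets[OF indep_var_rv1[OF VW] A'])
  show "prob (A \<inter> D) = prob A * prob D"
    unfolding AD by (simp only: indep_varD[OF VW A' D'] A_eq D_eq)
qed

text \<open>Finite-dimensional cylinder sets up to time \<open>t\<close> are stable under
  intersection and generate the filtration; the events of the increment are stable as well.
  Independence on such systems extends to the generated sigma-fields.\<close>

lemma wiener_increment_indep_filtration:
  assumes \<gamma>: "wiener_measure \<gamma>" and t: "0 \<le> t" "t < t'" "t' \<le> 1"
  shows "prob_space.indep_of \<gamma> (wiener_filtration t) borel (\<lambda>w. w t' - w t)"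
proof -
  interpret prob_space \<gamma> using \<gamma> by (simp add: wiener_measure_def)
  define \<C> where "\<C> = {{w \<in> wiener_space. \<forall>u\<in>U. w u \<in> B u} | U B.
    finite U \<and> U \<subseteq> {0..t} \<and> (\<forall>u. B u \<in> sets borel)}"
  define \<D> where "\<D> = {(\<lambda>w. w t' - w t) -` C \<inter> space \<gamma> | C. C \<in> sets borel}"
  have D[measurable]: "(\<lambda>w. w t' - w t) \<in> borel_measurable \<gamma>"
    using wiener_evaluation_measurable[OF \<gamma>] t by (intro borel_measurable_diff) auto
  have "Int_stable \<C>"
  proof (rule Int_stableI)
    fix A A' assume "A \<in> \<C>" "A' \<in> \<C>"
    then obtain U B U' B' where *: "A = {w \<in> wiener_space. \<forall>u\<in>U. w u \<in> B u}"
        "A' = {w \<in> wiener_space. \<forall>u\<in>U'. w u \<in> B' u}"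
        "finite U" "U \<subseteq> {0..t}" "\<forall>u. B u \<in> sets borel"
        "finite U'" "U' \<subseteq> {0..t}" "\<forall>u. B' u \<in> sets borel"
      unfolding \<C>_def by blast
    \<comment> \<open>One constraint for each time: a time restricted in only one of the two
      cylinders gets \<open>UNIV\<close> from the other.\<close>
    define C where "C u = (if u \<in> U then B u else UNIV) \<inter> (if u \<in> U' then B' u else UNIV)" for u
    have "A \<inter> A' = {w \<in> wiener_space. \<forall>u\<in>U \<union> U'. w u \<in> C u}"
      by (auto simp: * C_def)
    moreover have "\<forall>u. C u \<in> sets borel" using * by (auto simp: C_def)
    ultimately show "A \<inter> A' \<in> \<C>"
      unfolding \<C>_def using * by (intro CollectI exI[of _ "U \<union> U'"] exI[of _ C]) auto
  qed
  moreover have "Int_stable \<D>"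
  proof (rule Int_stableI)
    fix A A' assume "A \<in> \<D>" "A' \<in> \<D>"
    then obtain C C' where "A = (\<lambda>w. w t' - w t) -` C \<inter> space \<gamma>" "C \<in> sets borel"
      "A' = (\<lambda>w. w t' - w t) -` C' \<inter> space \<gamma>" "C' \<in> sets borel"
      unfolding \<D>_def by blast
    then show "A \<inter> A' \<in> \<D>"
      unfolding \<D>_def by (intro CollectI exI[of _ "C \<inter> C'"]) auto
  qed
  moreover have "indep_set \<C> \<D>"
    unfolding indep_sets2_eq
  proof (intro conjI ballI subsetI)
    show "A \<in> events" if "A \<in> \<C>" for A
      using that wiener_cylinder_increment_indep(1)[OF \<gamma> t, where C = UNIV]
      unfolding \<C>_def by (auto simp: space_wiener_measure[OF \<gamma>])
    show "A \<in> events" if "A \<in> \<D>" for A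
      using that unfolding \<D>_def by auto
    show "prob (A \<inter> A') = prob A * prob A'" if "A \<in> \<C>" "A' \<in> \<D>" for A A'
      using that wiener_cylinder_increment_indep(2)[OF \<gamma> t]
      unfolding \<C>_def \<D>_def by (auto simp: space_wiener_measure[OF \<gamma>])
  qed
  ultimately have "indep_set (sigma_sets (space \<gamma>) \<C>) (sigma_sets (space \<gamma>) \<D>)"
    by (intro indep_set_sigma_sets)
  moreover have "sets (wiener_filtration t) \<subseteq> sigma_sets (space \<gamma>) \<C>"
    unfolding sets_wiener_filtration space_wiener_measure[OF \<gamma>]
  proof (rule sigma_sets_mono', rule subsetI)
    fix A assume "A \<in> {{w \<in> wiener_space. w u \<in> B} | u B. u \<in> {0..t} \<and> B \<in> sets borel}"
    then obtain u B where "A = {w \<in> wiener_space. \<forall>u\<in>{u}. w u \<in> B}" "u \<in> {0..t}" "B \<in> sets borel"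
      by auto
    then show "A \<in> \<C>"
      unfolding \<C>_def by (intro CollectI exI[of _ "{u}"] exI[of _ "\<lambda>_. B"]) auto
  qed
  moreover have "\<D> \<subseteq> sigma_sets (space \<gamma>) \<D>" by auto
  ultimately have "indep_set (sets (wiener_filtration t)) \<D>"
    unfolding indep_sets2_eq by blast
  then show ?thesis
    using subalgebra_wiener_filtration[OF \<gamma>, of t] D t unfolding indep_of_def \<D>_def by simp
qed

section \<open>Dyadic refinement\<close>

text \<open>Cell by cell induction. The half-open cells omit 0, where the value is fixed by
  \<open>f 0 = 0\<close>. Integrability is part of the claim because additivity over the next cell
  requires it.\<close>

lemma step_function_integral:
  fixes f :: "real \<Rightarrow> real" and M :: nat
  assumes "0 < M" "f 0 = 0"
    and f: "\<And>j u. j < M \<Longrightarrow> u \<in> {real j / M<..real (Suc j) / M} \<Longrightarrow> f u = c j"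
    and "k \<le> M"
  shows "set_integrable lborel {0..real k / M} f \<and> (LINT u:{0..real k / M}|lborel. f u) = (\<Sum>j<k. c j / M)"
  using \<open>k \<le> M\<close>
proof (induction k)
  case 0
  have "(\<lambda>u. indicator {0::real} u * f u) = (\<lambda>_. 0)"
    using \<open>f 0 = 0\<close> by (auto simp: fun_eq_iff indicator_def)
  then show ?case by (simp add: set_integrable_def set_lebesgue_integral_def)
next
  case (Suc k)
  let ?J = "{real k / M<..real (Suc k) / M}"
  have "has_bochner_integral lborel (\<lambda>u. indicator ?J u *\<^sub>R c k) (measure lborel ?J *\<^sub>R c k)"
    by (rule has_bochner_integral_scaleR_left[OF has_bochner_integral_real_indicator])
      (use \<open>0 < M\<close> in \<open>auto simp: divide_right_mono\<close>)
  also have "(\<lambda>u. indicator ?J u *\<^sub>R c k) = (\<lambda>u. indicator ?J u *\<^sub>R f u)"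
    using f[of k] Suc.prems by (intro ext) (simp add: indicator_def)
  also have "measure lborel ?J *\<^sub>R c k = c k / M"
    using \<open>0 < M\<close> by (simp add: divide_right_mono field_simps)
  finally have J: "set_integrable lborel ?J f" "(LINT u:?J|lborel. f u) = c k / M"
    by (auto simp: has_bochner_integral_iff set_integrable_def set_lebesgue_integral_def)
  have un: "{0..real (Suc k) / M} = {0..real k / M} \<union> ?J"
  proof -
    have "{0..b} = {0..a} \<union> {a<..b}" if "0 \<le> a" "a \<le> b" for a b :: real
      using that by auto
    then show ?thesis by (simp add: divide_right_mono)
  qed
  have IH: "set_integrable lborel {0..real k / M} f"
      "(LINT u:{0..real k / M}|lborel. f u) = (\<Sum>j<k. c j / M)"
    using Suc by auto
  show ?case
    unfolding un using IH J
    by (subst set_integral_Un) (auto intro!: set_integrable_Un)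
qed

lemma step_rep_uniform:
  fixes f :: "real \<Rightarrow> real" and M :: nat
  assumes "0 < M"
    and f: "\<And>j u. j < M \<Longrightarrow> u \<in> {real j / M<..real (Suc j) / M} \<Longrightarrow> f u = c j"
  shows "step_rep f M (\<lambda>j. real j / M) c"
  unfolding step_rep_def
proof (intro conjI ballI allI impI)
  fix u :: real assume u: "u \<in> {0<..1}"
  have scale: "u \<in> {real i / M<..real (Suc i) / M} \<longleftrightarrow> real i < u * M \<and> u * M \<le> real (Suc i)" for i
    using \<open>0 < M\<close> by (simp add: pos_divide_less_eq pos_le_divide_eq)
  \<comment> \<open>The cell containing \<open>u\<close>. Cells are open on the left and closed on
    the right, hence a ceiling minus one; \<open>0 < u * M \<le> M\<close> places it among the
    \<open>M\<close> cells.\<close>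
  define j where "j = nat \<lceil>u * M\<rceil> - 1"
  have "0 < u * M" "u * M \<le> M" using u \<open>0 < M\<close> by (auto intro: mult_left_le_one_le)
  then have "0 < \<lceil>u * M\<rceil>" "\<lceil>u * M\<rceil> \<le> int M" by (simp_all add: ceiling_le_iff)
  then have "int (Suc j) = \<lceil>u * M\<rceil>" "j < M" unfolding j_def by linarith+
  then have "real (Suc j) = of_int \<lceil>u * M\<rceil>" by (metis of_int_of_nat_eq)
  then have j: "real j < u * M" "u * M \<le> real (Suc j)"
    using ceiling_correct[of "u * M"] by simp_all
  have "(\<Sum>i<M. c i * indicator {real i / M<..real (Suc i) / M} u) = (\<Sum>i<M. if i = j then c j else 0)"
  proof (rule sum.cong)
    fix i
    have "i = j" if "real i < u * M" "u * M \<le> real (Suc i)"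
    proof -
      have "real i < real (Suc j)" "real j < real (Suc i)" using that j by linarith+
      then show ?thesis unfolding of_nat_less_iff by simp
    qed
    then have "u \<in> {real i / M<..real (Suc i) / M} \<longleftrightarrow> i = j"
      using j scale by blast
    then show "c i * indicator {real i / M<..real (Suc i) / M} u = (if i = j then c j else 0)"
      by (simp only: indicator_def) simp
  qed simp
  then show "f u = (\<Sum>i<M. c i * indicator {real i / M<..real (Suc i) / M} u)"
    using f[OF \<open>j < M\<close>, of u] scale[of j] j \<open>j < M\<close> by simp
qed (use \<open>0 < M\<close> in \<open>auto simp: divide_strict_right_mono\<close>)

text \<open>Every break point of level \<open>s\<close> is a grid point of level \<open>m\<close>,
  so none lies inside a cell of level \<open>m\<close>, and \<open>z\<close> keeps on the cell its
  value at the right end. A term that is nonzero there belongs to an interval starting no later than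
  the left end of the cell, so its coefficient is known by then.\<close>

lemma simple_predictable_refine:
  assumes z: "simple_predictable s \<zeta> z" and "s \<le> m"
  shows "z w 0 = 0"
    and "u \<in> {real j / 2 ^ m<..real (Suc j) / 2 ^ m} \<Longrightarrow> z w u = z w (real (Suc j) / 2 ^ m)"
    and "j < 2 ^ m \<Longrightarrow> (\<lambda>w. z w (real (Suc j) / 2 ^ m)) \<in> borel_measurable (wiener_filtration (real j / 2 ^ m))"
proof -
  obtain d where m: "m = s + d" using \<open>s \<le> m\<close> le_Suc_ex by blast
  have z_eq: "z w t = (\<Sum>k=1..2 ^ s. 2 powr (real s / 2) * \<zeta> k w *
        indicator {(real k - 1) / 2 ^ s<..real k / 2 ^ s} t)" for w t
    using z by (simp add: simple_predictable_def)
  have fine: "real i / 2 ^ s = real (i * 2 ^ d) / 2 ^ m" for i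
    by (simp add: m power_add)
  \<comment> \<open>Both sides compare integers over the common denominator \<open>2 ^ m\<close>, so
    being below the right end of a cell means being at most its left end.\<close>
  have left: "(real k - 1) / 2 ^ s < real (Suc j) / 2 ^ m \<longleftrightarrow> (real k - 1) / 2 ^ s \<le> real j / 2 ^ m"
    if "1 \<le> k" for k j :: nat
  proof -
    have "real k - 1 = real (k - 1)" using that by simp
    then show ?thesis
      by (simp only: fine divide_less_cancel divide_le_cancel of_nat_less_iff of_nat_le_iff) (simp add: less_Suc_eq_le)
  qed
  have right: "real j / 2 ^ m < real k / 2 ^ s \<longleftrightarrow> real (Suc j) / 2 ^ m \<le> real k / 2 ^ s"
    for k j :: nat
    by (simp only: fine divide_less_cancel divide_le_cancel of_nat_less_iff of_nat_le_iff) (simp add: Suc_le_eq)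
  show "z w 0 = 0"
    unfolding z_eq
  proof (rule sum.neutral, rule ballI)
    fix k :: nat assume "k \<in> {1..2 ^ s}"
    then have 0: "0 \<notin> {(real k - 1) / 2 ^ s<..real k / 2 ^ s}" by (simp add: not_less)
    show "2 powr (real s / 2) * \<zeta> k w * indicator {(real k - 1) / 2 ^ s<..real k / 2 ^ s} 0 = 0"
      by (simp only: indicator_simps(2)[OF 0] mult_zero_right)
  qed
  show "z w u = z w (real (Suc j) / 2 ^ m)" if u: "u \<in> {real j / 2 ^ m<..real (Suc j) / 2 ^ m}"
    unfolding z_eq
  proof (rule sum.cong)
    fix k :: nat assume "k \<in> {1..2 ^ s}"
    then have "u \<in> {(real k - 1) / 2 ^ s<..real k / 2 ^ s} \<longleftrightarrow>
        real (Suc j) / 2 ^ m \<in> {(real k - 1) / 2 ^ s<..real k / 2 ^ s}"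
      using u left[of k j] right[of j k] by (auto simp del: of_nat_Suc)
    then show "2 powr (real s / 2) * \<zeta> k w * indicator {(real k - 1) / 2 ^ s<..real k / 2 ^ s} u =
        2 powr (real s / 2) * \<zeta> k w * indicator {(real k - 1) / 2 ^ s<..real k / 2 ^ s} (real (Suc j) / 2 ^ m)"
      by (simp add: indicator_def)
  qed simp
  show "(\<lambda>w. z w (real (Suc j) / 2 ^ m)) \<in> borel_measurable (wiener_filtration (real j / 2 ^ m))"
    unfolding z_eq
  proof (rule borel_measurable_sum)
    fix k :: nat assume k: "k \<in> {1..2 ^ s}"
    show "(\<lambda>w. 2 powr (real s / 2) * \<zeta> k w *
        indicator {(real k - 1) / 2 ^ s<..real k / 2 ^ s} (real (Suc j) / 2 ^ m))
      \<in> borel_measurable (wiener_filtration (real j / 2 ^ m))"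
    \<comment> \<open>An interval that starts at or after the right end of the cell contributes 0
      there.\<close>
    proof (cases "(real k - 1) / 2 ^ s < real (Suc j) / 2 ^ m")
      case True
      then have "(real k - 1) / 2 ^ s \<le> real j / 2 ^ m" using left k by simp
      moreover have "\<zeta> k \<in> borel_measurable (wiener_filtration ((real k - 1) / 2 ^ s))"
        using z k by (simp add: simple_predictable_def)
      ultimately have [measurable]: "\<zeta> k \<in> borel_measurable (wiener_filtration (real j / 2 ^ m))"
        by (metis borel_measurable_wiener_filtration_mono)
      show ?thesis by measurable
    qed (simp add: indicator_def)
  qed
qed

section \<open>Polynomial functionals: finite-dimensional form and moments\<close>

definition dyadic_increments :: "nat \<Rightarrow> (real \<Rightarrow> real) \<Rightarrow> nat \<Rightarrow> real" where
  "dyadic_increments m w j =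
     (if j < 2 ^ m then w (real (Suc j) / 2 ^ m) - w (real j / 2 ^ m) else 0)"

text \<open>Claiming this for all levels from some \<open>l\<close> on lets the induction combine
  functionals of different levels and leaves room to exceed the level of \<open>z\<close>. The
  identity holds for every function \<open>w\<close>, so it can be evaluated at a shifted
  path.\<close>

lemma polynomial_functional_of_dyadic_increments:
  assumes "F \<in> polynomial_functionals"
  shows "\<exists>l. \<forall>m\<ge>l. \<exists>P\<in>borel_measurable (Pi\<^sub>M UNIV (\<lambda>_::nat. borel)). \<forall>w.
    F w = P (dyadic_increments m w)"
  using assms
proof induction
  case (const a)
  show ?case by (auto intro!: bexI[of _ "\<lambda>_. a"])
next
  case (sigma k s)
  show ?case
  proof (intro exI[of _ s] allI impI)
    fix m assume "s \<le> m"
    then obtain d where m: "m = s + d" using le_Suc_ex by blast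
    \<comment> \<open>The level \<open>m\<close> cells that fill the \<open>k\<close>-th interval of
      level \<open>s\<close>. Intervals are counted from 1 and cells from 0; the increments over
      \<open>K\<close> telescope.\<close>
    define K where "K = {(k - 1) * 2 ^ d..<k * 2 ^ d}"
    have K: "K \<subseteq> {..<2 ^ m}"
      using sigma by (auto simp: K_def m power_add intro: less_le_trans)
    show "\<exists>P\<in>borel_measurable (Pi\<^sub>M UNIV (\<lambda>_::nat. borel)). \<forall>w. stoch_integral (sigma_dot s k) w =
        P (dyadic_increments m w)"
    proof (intro bexI[of _ "\<lambda>y. 2 powr (real s / 2) * (\<Sum>j\<in>K. y j)"] allI)
      fix w :: "real \<Rightarrow> real"
      have "(\<Sum>j\<in>K. dyadic_increments m w j) =
          (\<Sum>j\<in>K. w (real (Suc j) / 2 ^ m) - w (real j / 2 ^ m))"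
        using K by (intro sum.cong) (auto simp: dyadic_increments_def)
      also have "\<dots> = w (real (k * 2 ^ d) / 2 ^ m) - w (real ((k - 1) * 2 ^ d) / 2 ^ m)"
        unfolding K_def by (rule sum_Suc_diff'[where f = "\<lambda>i. w (real i / 2 ^ m)"]) simp
      also have "\<dots> = w (real k / 2 ^ s) - w ((real k - 1) / 2 ^ s)"
        using sigma by (simp add: m power_add of_nat_diff)
      finally show "stoch_integral (sigma_dot s k) w = 2 powr (real s / 2) *
          (\<Sum>j\<in>K. dyadic_increments m w j)"
        by (simp add: stoch_integral_sigma_dot[OF sigma])
    qed (auto intro!: borel_measurable_times borel_measurable_sum)
  qed
next
  case (add F G)
  then obtain l l' where
    l: "\<forall>m\<ge>l. \<exists>P\<in>borel_measurable (Pi\<^sub>M UNIV (\<lambda>_::nat. borel)). \<forall>w. F w = P (dyadic_increments m w)" and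
    l': "\<forall>m\<ge>l'. \<exists>P\<in>borel_measurable (Pi\<^sub>M UNIV (\<lambda>_::nat. borel)). \<forall>w. G w = P (dyadic_increments m w)"
    by blast
  show ?case
  proof (intro exI[of _ "max l l'"] allI impI)
    fix m assume "max l l' \<le> m"
    then obtain P Q where "P \<in> borel_measurable (Pi\<^sub>M UNIV (\<lambda>_::nat. borel))" "\<forall>w. F w = P (dyadic_increments m w)"
      "Q \<in> borel_measurable (Pi\<^sub>M UNIV (\<lambda>_::nat. borel))" "\<forall>w. G w = Q (dyadic_increments m w)"
      using l l' by (meson max.boundedE)
    then show "\<exists>P\<in>borel_measurable (Pi\<^sub>M UNIV (\<lambda>_::nat. borel)). \<forall>w. F w + G w = P (dyadic_increments m w)"
      by (intro bexI[of _ "\<lambda>y. P y + Q y"]) auto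
  qed
next
  case (mult F G)
  then obtain l l' where
    l: "\<forall>m\<ge>l. \<exists>P\<in>borel_measurable (Pi\<^sub>M UNIV (\<lambda>_::nat. borel)). \<forall>w. F w = P (dyadic_increments m w)" and
    l': "\<forall>m\<ge>l'. \<exists>P\<in>borel_measurable (Pi\<^sub>M UNIV (\<lambda>_::nat. borel)). \<forall>w. G w = P (dyadic_increments m w)"
    by blast
  show ?case
  proof (intro exI[of _ "max l l'"] allI impI)
    fix m assume "max l l' \<le> m"
    then obtain P Q where "P \<in> borel_measurable (Pi\<^sub>M UNIV (\<lambda>_::nat. borel))" "\<forall>w. F w = P (dyadic_increments m w)"
      "Q \<in> borel_measurable (Pi\<^sub>M UNIV (\<lambda>_::nat. borel))" "\<forall>w. G w = Q (dyadic_increments m w)"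
      using l l' by (meson max.boundedE)
    then show "\<exists>P\<in>borel_measurable (Pi\<^sub>M UNIV (\<lambda>_::nat. borel)). \<forall>w. F w * G w = P (dyadic_increments m w)"
      by (intro bexI[of _ "\<lambda>y. P y * Q y"]) auto
  qed
qed

text \<open>Integrability alone does not survive products, so the induction carries all absolute
  moments: the \<open>p\<close>-th moment of a product is bounded by the moments of order
  \<open>2 * p\<close> of its factors. The generators are multiples of normal variables.\<close>

lemma polynomial_functional_moments:
  assumes \<gamma>: "wiener_measure \<gamma>" and "F \<in> polynomial_functionals"
  shows "F \<in> borel_measurable \<gamma> \<and> (\<forall>p. integrable \<gamma> (\<lambda>w. \<bar>F w\<bar> ^ p))"
  using assms(2)
proof induction
  case (const a)
  interpret prob_space \<gamma> using \<gamma> by (simp add: wiener_measure_def)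
  show ?case by simp
next
  case (sigma k s)
  define a b where "a = (real k - 1) / 2 ^ s" and "b = real k / 2 ^ s"
  have "0 \<le> a" "a < b" "b \<le> 1"
    using sigma by (auto simp: a_def b_def divide_strict_right_mono)
  then have D: "distributed \<gamma> lborel (\<lambda>w. w b - w a) (normal_density 0 (sqrt (b - a)))"
    using \<gamma> by (simp add: wiener_measure_def)
  have [measurable]: "(\<lambda>w. w b - w a) \<in> borel_measurable \<gamma>"
    using D by (simp add: distributed_def)
  have "integrable \<gamma> (\<lambda>w. \<bar>w b - w a\<bar> ^ p)" for p
    using integrable_normal_moment_abs[of "sqrt (b - a)" 0 p] \<open>a < b\<close>
    by (subst distributed_integrable[OF D, symmetric]) auto
  then show ?case
    by (simp add: stoch_integral_sigma_dot[OF sigma] a_def[symmetric] b_def[symmetric] abs_mult power_mult_distrib)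
next
  case (add F G)
  then have [measurable]: "F \<in> borel_measurable \<gamma>" "G \<in> borel_measurable \<gamma>"
    and moments: "integrable \<gamma> (\<lambda>w. \<bar>F w\<bar> ^ p)" "integrable \<gamma> (\<lambda>w. \<bar>G w\<bar> ^ p)" for p
    by blast+
  have "integrable \<gamma> (\<lambda>w. \<bar>F w + G w\<bar> ^ p)" for p
  proof (rule Bochner_Integration.integrable_bound)
    show "integrable \<gamma> (\<lambda>w. 2 ^ p * (\<bar>F w\<bar> ^ p + \<bar>G w\<bar> ^ p))" by (intro integrable_mult_right Bochner_Integration.integrable_add moments)
    have bound: "\<bar>x + y\<bar> ^ p \<le> 2 ^ p * (\<bar>x\<bar> ^ p + \<bar>y\<bar> ^ p)" for x y :: real
    proof -
      have "\<bar>x + y\<bar> ^ p \<le> (2 * max \<bar>x\<bar> \<bar>y\<bar>) ^ p" by (rule power_mono) auto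
      also have "\<dots> = 2 ^ p * max \<bar>x\<bar> \<bar>y\<bar> ^ p" by (rule power_mult_distrib)
      also have "max \<bar>x\<bar> \<bar>y\<bar> ^ p \<le> \<bar>x\<bar> ^ p + \<bar>y\<bar> ^ p"
        by (cases "\<bar>x\<bar> \<le> \<bar>y\<bar>") (simp_all add: max_def)
      finally show ?thesis by simp
    qed
    show "AE w in \<gamma>. norm (\<bar>F w + G w\<bar> ^ p) \<le> norm (2 ^ p * (\<bar>F w\<bar> ^ p + \<bar>G w\<bar> ^ p))"
    proof (rule AE_I2)
      fix w
      have "norm (\<bar>F w + G w\<bar> ^ p) = \<bar>F w + G w\<bar> ^ p" by simp
      also note bound[of "F w" "G w"]
      also have "2 ^ p * (\<bar>F w\<bar> ^ p + \<bar>G w\<bar> ^ p) \<le> norm (2 ^ p * (\<bar>F w\<bar> ^ p + \<bar>G w\<bar> ^ p))" by (simp only: real_norm_def abs_ge_self)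
      finally show "norm (\<bar>F w + G w\<bar> ^ p) \<le> norm (2 ^ p * (\<bar>F w\<bar> ^ p + \<bar>G w\<bar> ^ p))" .
    qed
  qed simp
  then show ?case by (intro conjI allI) measurable
next
  case (mult F G)
  then have [measurable]: "F \<in> borel_measurable \<gamma>" "G \<in> borel_measurable \<gamma>"
    and moments: "integrable \<gamma> (\<lambda>w. \<bar>F w\<bar> ^ p)" "integrable \<gamma> (\<lambda>w. \<bar>G w\<bar> ^ p)" for p
    by blast+
  have "integrable \<gamma> (\<lambda>w. \<bar>F w * G w\<bar> ^ p)" for p
  proof (rule Bochner_Integration.integrable_bound)
    show "integrable \<gamma> (\<lambda>w. \<bar>F w\<bar> ^ (2 * p) + \<bar>G w\<bar> ^ (2 * p))" by (intro Bochner_Integration.integrable_add moments)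
    have bound: "\<bar>x * y\<bar> ^ p \<le> \<bar>x\<bar> ^ (2 * p) + \<bar>y\<bar> ^ (2 * p)" for x y :: real
    proof -
      have "2 * (\<bar>x\<bar> ^ p * \<bar>y\<bar> ^ p) \<le> (\<bar>x\<bar> ^ p)\<^sup>2 + (\<bar>y\<bar> ^ p)\<^sup>2"
        using sum_squares_bound[of "\<bar>x\<bar> ^ p" "\<bar>y\<bar> ^ p"] by simp
      moreover have "0 \<le> \<bar>x\<bar> ^ p * \<bar>y\<bar> ^ p" by simp
      moreover have "\<bar>x\<bar> ^ (2 * p) = (\<bar>x\<bar> ^ p)\<^sup>2" "\<bar>y\<bar> ^ (2 * p) = (\<bar>y\<bar> ^ p)\<^sup>2"
        by (simp_all only: power_mult[symmetric] mult.commute)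
      moreover have "\<bar>x * y\<bar> ^ p = \<bar>x\<bar> ^ p * \<bar>y\<bar> ^ p"
        by (simp only: abs_mult power_mult_distrib)
      ultimately show ?thesis by linarith
    qed
    show "AE w in \<gamma>. norm (\<bar>F w * G w\<bar> ^ p) \<le> norm (\<bar>F w\<bar> ^ (2 * p) + \<bar>G w\<bar> ^ (2 * p))"
    proof (rule AE_I2)
      fix w
      have "norm (\<bar>F w * G w\<bar> ^ p) = \<bar>F w * G w\<bar> ^ p" by simp
      also note bound[of "F w" "G w"]
      also have "\<bar>F w\<bar> ^ (2 * p) + \<bar>G w\<bar> ^ (2 * p) \<le> norm (\<bar>F w\<bar> ^ (2 * p) + \<bar>G w\<bar> ^ (2 * p))" by (simp only: real_norm_def abs_ge_self)
      finally show "norm (\<bar>F w * G w\<bar> ^ p) \<le> norm (\<bar>F w\<bar> ^ (2 * p) + \<bar>G w\<bar> ^ (2 * p))" .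
    qed
  qed simp
  then show ?case by (intro conjI allI) measurable
qed

section \<open>Transfer of the discrete identity to Wiener space\<close>

theorem corollary4p4:
  fixes \<gamma> :: "(real \<Rightarrow> real) measure"
    and s :: nat
    and \<zeta> :: "nat \<Rightarrow> (real \<Rightarrow> real) \<Rightarrow> real"
    and z :: "(real \<Rightarrow> real) \<Rightarrow> real \<Rightarrow> real"
    and F :: "(real \<Rightarrow> real) \<Rightarrow> real"
  assumes "wiener_measure \<gamma>"
    and "simple_predictable s \<zeta> z"
    and "F \<in> polynomial_functionals"
  shows "integrable \<gamma> F \<and>
    integrable \<gamma> (\<lambda>w. F (drift_shift z w) *
      exp (stoch_integral (z w) w - 1 / 2 * (LINT t:{0..1}|lborel. \<bar>z w t\<bar>\<^sup>2))) \<and>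
    (LINT w|\<gamma>. F (drift_shift z w) *
      exp (stoch_integral (z w) w - 1 / 2 * (LINT t:{0..1}|lborel. \<bar>z w t\<bar>\<^sup>2)))
    = (LINT w|\<gamma>. F w)"
proof -
  interpret prob_space \<gamma> using assms(1) by (simp add: wiener_measure_def)
  note moments = polynomial_functional_moments[OF assms(1,3)]
  have F[measurable]: "F \<in> borel_measurable \<gamma>" using moments by (rule conjunct1)
  have "integrable \<gamma> (\<lambda>w. \<bar>F w\<bar> ^ 1)" using moments[THEN conjunct2] by (rule spec)
  then have int_F: "integrable \<gamma> F" unfolding power_one_right integrable_abs_iff[OF F] .
  obtain l where l: "\<forall>m\<ge>l. \<exists>P\<in>borel_measurable (Pi\<^sub>M UNIV (\<lambda>_::nat. borel)). \<forall>w.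
      F w = P (dyadic_increments m w)"
    using polynomial_functional_of_dyadic_increments[OF assms(3)] by blast
  \<comment> \<open>At least \<open>l\<close>, so that \<open>F\<close> is a function of the
    increments of level \<open>m\<close>, and at least \<open>s\<close>, so that \<open>z\<close> is
    constant on the cells.\<close>
  define m where "m = max l s"
  define N :: nat where "N = 2 ^ m"
  have N: "0 < N" "2 ^ m = real N" by (simp_all add: N_def)
  define X where "X j w = w (real (Suc j) / N) - w (real j / N)" for j :: nat and w :: "real \<Rightarrow> real"
  define a where "a j w = z w (real (Suc j) / N)" for j :: nat and w :: "real \<Rightarrow> real"
  define v where "v = 1 / real N"
  define E where "E w = exp (\<Sum>j<N. a j w * X j w - (a j w)\<^sup>2 * v / 2)" for w
  define U where "U w = (\<lambda>j. if j < N then X j w - a j w * v else 0)" for w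
  define V where "V w = (\<lambda>j. if j < N then X j w else 0)" for w
  obtain P where P[measurable]: "P \<in> borel_measurable (Pi\<^sub>M UNIV (\<lambda>_::nat. borel))"
    and F_eq: "\<And>w. F w = P (\<lambda>j. if j < N then X j w else 0)"
    using l[rule_format, of m] unfolding X_def dyadic_increments_def[abs_def] N N_def[symmetric] by (auto simp: m_def)

  have "s \<le> m" by (simp add: m_def)
  note refine = simple_predictable_refine[OF assms(2) this, unfolded N, folded a_def N_def]
  have zsq: "\<bar>z w 0\<bar>\<^sup>2 = 0" "\<And>j u. j < N \<Longrightarrow> u \<in> {real j / N<..real (Suc j) / N} \<Longrightarrow> \<bar>z w u\<bar>\<^sup>2 = (a j w)\<^sup>2" for w
    using refine(1,2) by simp_all
  have drift: "(LINT u:{0..real k / N}|lborel. z w u) = (\<Sum>j<k. a j w / N)" if "k \<le> N" for k w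
    using step_function_integral[of N "z w" "\<lambda>j. a j w" k] N refine that by blast
  have energy: "(LINT t:{0..1}|lborel. \<bar>z w t\<bar>\<^sup>2) = (\<Sum>j<N. (a j w)\<^sup>2 / N)" for w
    using step_function_integral[of N "\<lambda>u. \<bar>z w u\<bar>\<^sup>2" "\<lambda>j. (a j w)\<^sup>2" N] N zsq by simp
  \<comment> \<open>The elementary integral is independent of the representation of the step
    function, so the finer grid may be used.\<close>
  have ito: "stoch_integral (z w) w = (\<Sum>j<N. a j w * X j w)" for w
    unfolding X_def by (rule stoch_integral_eq, rule step_rep_uniform) (use N refine in auto)
  have exponential: "exp (stoch_integral (z w) w - 1 / 2 * (LINT t:{0..1}|lborel. \<bar>z w t\<bar>\<^sup>2)) = E w" for w
    unfolding E_def ito energy by (simp add: v_def sum_subtractf sum_distrib_left mult.commute)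
  \<comment> \<open>The drift integrals up to two neighbouring grid times differ by the one term
    \<open>a j w / N\<close>. Both times must lie in \<open>{0..1}\<close>, where
    \<open>drift_shift\<close> is given by its formula.\<close>
  have "X j (drift_shift z w) = X j w - a j w * v" if "j < N" for j w
  proof -
    have "real j / N \<in> {0..1}" "real (Suc j) / N \<in> {0..1}" using that by auto
    then show ?thesis
      using drift[of j w] drift[of "Suc j" w] that by (simp add: X_def drift_shift_def v_def)
  qed
  then have F_shift: "F (drift_shift z w) = P (U w)" for w
    unfolding F_eq U_def by (intro arg_cong[where f = P]) (simp add: fun_eq_iff)

  define \<F> where "\<F> j = wiener_filtration (real j / N)" for j
  have X\<F>: "X j \<in> borel_measurable (\<F> n)" if "j < n" "n < N" for j n
    unfolding X_def \<F>_def using that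
    by (intro borel_measurable_diff wiener_filtration_evaluation_measurable) (auto simp: divide_right_mono)
  have a\<F>: "a j \<in> borel_measurable (\<F> n)" if "j \<le> n" "n < N" for j n
  proof -
    \<comment> \<open>Predictability: \<open>a j\<close> is read off at the right end of cell
      \<open>j\<close> but known at its left end.\<close>
    have "a j \<in> borel_measurable (wiener_filtration (real j / N))"
      using refine(3)[of j] that by simp
    then show ?thesis
      unfolding \<F>_def
      by (rule borel_measurable_wiener_filtration_mono) (use that in \<open>simp add: divide_right_mono\<close>)
  qed
  have grid: "0 \<le> real n / N" "real n / N < real (Suc n) / N" "real (Suc n) / N \<le> 1"
    "real (Suc n) / N - real n / N = v" if "n < N" for n
    using that by (auto simp: divide_strict_right_mono v_def diff_divide_distrib[symmetric])
  have X_dist: "distributed \<gamma> lborel (X n) (normal_density 0 (sqrt v))" if "n < N" for n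
    using wiener_increment_distributed[OF assms(1) grid(1-3)[OF that]]
    unfolding X_def grid(4)[OF that] .
  have X_ind: "indep_of (\<F> n) borel (X n)" if "n < N" for n
    using wiener_increment_indep_filtration[OF assms(1) grid(1-3)[OF that]]
    unfolding X_def \<F>_def .
  have "0 < v" using N by (simp add: v_def)
  note girsanov = gaussian_girsanov_distr[OF this X_dist X_ind X\<F> a\<F>]
  have E[measurable]: "E \<in> borel_measurable \<gamma>"
    unfolding E_def[abs_def] by (rule girsanov(1))
  have U[measurable]: "U \<in> measurable \<gamma> (Pi\<^sub>M UNIV (\<lambda>_. borel))"
    unfolding U_def[abs_def] by (rule girsanov(2))
  have V[measurable]: "V \<in> measurable \<gamma> (Pi\<^sub>M UNIV (\<lambda>_. borel))"
    unfolding V_def[abs_def] by (rule girsanov(3))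
  have law: "distr (density \<gamma> E) (Pi\<^sub>M UNIV (\<lambda>_. borel)) U = distr \<gamma> (Pi\<^sub>M UNIV (\<lambda>_. borel)) V"
    unfolding E_def[abs_def] U_def[abs_def] V_def[abs_def] by (rule girsanov(4))
  have E_nonneg: "AE w in \<gamma>. 0 \<le> E w" by (simp add: E_def)
  have FV: "F = (\<lambda>w. P (V w))" by (simp add: F_eq V_def fun_eq_iff)
  \<comment> \<open>Integrability of \<open>F\<close> passes to the common law and from there to the
    weighted shifted functional, whatever the size of \<open>z\<close>.\<close>
  have "integrable (distr \<gamma> (Pi\<^sub>M UNIV (\<lambda>_. borel)) V) P"
    using int_F unfolding FV by (simp add: integrable_distr_eq)
  then have "integrable (density \<gamma> E) (\<lambda>w. P (U w))"
    unfolding law[symmetric] by (simp add: integrable_distr_eq)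
  then have int_shift: "integrable \<gamma> (\<lambda>w. P (U w) * E w)"
    using E_nonneg by (simp add: integrable_density mult.commute)
  have "(LINT w|\<gamma>. P (U w) * E w) = (LINT w|density \<gamma> E. P (U w))"
    using E_nonneg by (simp add: integral_density mult.commute)
  also have "\<dots> = (LINT y|distr (density \<gamma> E) (Pi\<^sub>M UNIV (\<lambda>_. borel)) U. P y)"
    by (simp add: integral_distr)
  also have "\<dots> = (LINT w|\<gamma>. F w)"
    unfolding law FV by (simp add: integral_distr)
  finally show ?thesis
    unfolding exponential F_shift using int_F int_shift by blast
qed

end
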